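(* Any randomized sampling/histogramming partitioning algorithm (model in the context) that uses $O(p)$ samples in each superstep and that, for every input, achieves a $2$-balanced partition with probability greater than $1/2$, requires $\Omega(\log^* p)$ supersteps, for all sufficiently large $p$ (and sufficiently large $N$).
   Context: Model: $N$ distinct keys from a totally ordered set (only comparisons available) are distributed across $p$ processors, $N/p$ keys per processor; $R(x)$ is the global rank of key $x$. The algorithm proceeds in supersteps. In each superstep, processors choose keys from their local inputs as samples (the choice may depend on local input, on all information made available in earlier supersteps, and on random bits); the global ranks of all samples are then computed and made known to all processors. At the end, the algorithm outputs splitters $s_1,\dots,s_{p-1}$ chosen among the sampled keys. With $R(s_0)=0$, $R(s_p)=N$, the partition is $2$-balanced if $R(s_{i+1})-R(s_i)\le 2\frac{N}{p}$ for all $i\in\{0,\dots,p-1\}$. $\log^* x=0$ for $x\le1$ and $\log^* x=1+\log^*(\log x)$ for $x>1$. *)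

theory Defs
  imports "HOL-Probability.Probability"
begin

definition log_star :: "real \<Rightarrow> nat" where
  "log_star x = (LEAST k. ((\<lambda>y. log 2 y) ^^ k) x \<le> 1)"

text \<open>An input (up to order type, which is all a comparison algorithm can see):
  rk i j is the global rank (in 1..N) of the key stored at local memory position j of
  processor i (i < p, j < N/p).\<close>
type_synonym input = "nat \<Rightarrow> nat \<Rightarrow> nat"

definition valid_input :: "nat \<Rightarrow> nat \<Rightarrow> input \<Rightarrow> bool" where
  "valid_input p N rk \<longleftrightarrow> 0 < p \<and> p dvd N \<and>
     bij_betw (\<lambda>(i, j). rk i j) ({..<p} \<times> {..<N div p}) {1..N}"

text \<open>Transcript: for each completed superstep, the set of samples (processor, local position,
  global rank).  This is the public information.\<close>
type_synonym transcript = "(nat \<times> nat \<times> nat) set list"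

definition tranks :: "transcript \<Rightarrow> nat set" where
  "tranks T = {x. \<exists>S\<in>set T. \<exists>i j. (i, j, x) \<in> S}"

definition sampled :: "transcript \<Rightarrow> (nat \<times> nat) set" where
  "sampled T = {(i, j). \<exists>S\<in>set T. \<exists>x. (i, j, x) \<in> S}"

type_synonym lview = "(nat \<Rightarrow> nat \<Rightarrow> bool) \<times> (nat \<Rightarrow> nat \<Rightarrow> bool)"

definition local_view :: "nat \<Rightarrow> input \<Rightarrow> nat \<Rightarrow> transcript \<Rightarrow> lview" where
  "local_view m rk i T =
     (\<lambda>j k. j < m \<and> k < m \<and> rk i j < rk i k,
      \<lambda>j x. j < m \<and> x \<in> tranks T \<and> rk i j < x)"

text \<open>A randomized sampling strategy: given random seed, superstep index, processor index,
  its private view and the public transcript, the set of local positions it samples.\<close>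
type_synonym strategy = "nat \<Rightarrow> nat \<Rightarrow> nat \<Rightarrow> lview \<Rightarrow> transcript \<Rightarrow> nat set"

text \<open>Output rule: from the seed and final transcript, the list of splitters
  (given as processor/local position of sampled keys).\<close>
type_synonym outrule = "nat \<Rightarrow> transcript \<Rightarrow> (nat \<times> nat) list"

definition step_samples ::
  "strategy \<Rightarrow> nat \<Rightarrow> nat \<Rightarrow> nat \<Rightarrow> input \<Rightarrow> nat \<Rightarrow> transcript \<Rightarrow> (nat \<times> nat \<times> nat) set" where
  "step_samples A p m \<omega> rk t T =
     {(i, j, rk i j) | i j. i < p \<and> j < m \<and> j \<in> A \<omega> t i (local_view m rk i T) T}"

fun run :: "strategy \<Rightarrow> nat \<Rightarrow> nat \<Rightarrow> nat \<Rightarrow> input \<Rightarrow> nat \<Rightarrow> transcript" where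
  "run A p m \<omega> rk 0 = []"
| "run A p m \<omega> rk (Suc t) =
     (let T = run A p m \<omega> rk t in T @ [step_samples A p m \<omega> rk t T])"

definition two_balanced :: "nat \<Rightarrow> nat \<Rightarrow> nat list \<Rightarrow> bool" where
  "two_balanced p N rs \<longleftrightarrow> length rs = p - 1 \<and>
     (let qs = 0 # sort rs @ [N] in
        \<forall>i<p. real (qs ! Suc i) - real (qs ! i) \<le> 2 * real N / real p)"

definition success ::
  "strategy \<Rightarrow> outrule \<Rightarrow> nat \<Rightarrow> nat \<Rightarrow> nat \<Rightarrow> input \<Rightarrow> nat \<Rightarrow> bool" where
  "success A out p N r rk \<omega> \<longleftrightarrow>
     (let T = run A p (N div p) \<omega> rk r; s = out \<omega> T in
        set s \<subseteq> sampled T \<and> two_balanced p N (map (\<lambda>(i, j). rk i j) s))"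

end

theory Submission
  imports Defs
begin

text \<open>By averaging it suffices to give a distribution on inputs on which every deterministic
  algorithm with few supersteps fails more often than not. Cut the ranks into many units, each
  shared by a group of processors, and order the sections inside a unit by levels that are revealed
  one fair bit per superstep. As long as no sample lies in the current window of a unit, the
  comparisons made so far do not depend on the later bits of that unit. If a superstep places
  \<open>\<lambda>\<close> samples into a window, then with probability at least \<open>2 powr - (\<lambda> + 1)\<close> the
  next bit moves all of them out of the window while keeping a quarter of its sections. With \<open>O(p)\<close>
  samples the proportion of surviving units thus drops from \<open>1/D\<close> to about
  \<open>2 powr - O(D)\<close>, so a unit survives unless the number of supersteps is of order
  \<open>log_star p\<close>. The window of a surviving unit has more than \<open>2 * N / p\<close> consecutive
  ranks and no sample.\<close>

section \<open>Counting subsets\<close>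

text \<open>Of \<open>Z\<close> and \<open>B - Z\<close> at least one contains half of
  \<open>B\<close>, so the large subsets and their complements cover \<open>Pow B\<close>.\<close>

lemma card_large_subsets:
  assumes "finite B"
  shows "2 ^ card B \<le> 2 * card {Z. Z \<subseteq> B \<and> card B \<le> 2 * card Z}"
proof -
  let ?H = "{Z. Z \<subseteq> B \<and> card B \<le> 2 * card Z}"
  have fin: "finite ?H" using assms by simp
  have "Pow B \<subseteq> ?H \<union> (\<lambda>Z. B - Z) ` ?H"
  proof
    fix Z assume "Z \<in> Pow B"
    then have Z: "Z \<subseteq> B" by simp
    have "card (B - Z) = card B - card Z" "card Z \<le> card B"
      using Z assms by (auto simp: card_Diff_subset finite_subset card_mono)
    then have "Z \<in> ?H \<or> B - Z \<in> ?H" using Z by auto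
    moreover have "Z = B - (B - Z)" using Z by auto
    ultimately show "Z \<in> ?H \<union> (\<lambda>Z. B - Z) ` ?H" by blast
  qed
  then have "card (Pow B) \<le> card (?H \<union> (\<lambda>Z. B - Z) ` ?H)"
    using fin by (intro card_mono) auto
  also have "\<dots> \<le> card ?H + card ((\<lambda>Z. B - Z) ` ?H)" by (rule card_Un_le)
  also have "\<dots> \<le> 2 * card ?H" using card_image_le[OF fin, of "\<lambda>Z. B - Z"] by simp
  finally show ?thesis using assms by (simp add: card_Pow)
qed

text \<open>Keeping clear of \<open>Q\<close> costs a factor of at most \<open>2 ^ l\<close>. Since
  \<open>A - Q\<close> keeps half of \<open>A\<close>, half of \<open>A - Q\<close> is a quarter of
  \<open>A\<close>, and this costs one more factor 2.\<close>

lemma card_avoiding_large_subsets: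
  assumes "finite A" "Q \<subseteq> A" "card Q \<le> l" "2 * l \<le> card A"
  shows "2 ^ card A \<le> 2 ^ (l + 1) * card {Z. Z \<subseteq> A \<and> Z \<inter> Q = {} \<and> card A \<le> 4 * card Z}"
proof -
  let ?B = "A - Q"
  let ?H = "{Z. Z \<subseteq> ?B \<and> card ?B \<le> 2 * card Z}"
  let ?S = "{Z. Z \<subseteq> A \<and> Z \<inter> Q = {} \<and> card A \<le> 4 * card Z}"
  have B: "card ?B + card Q = card A"
    using assms by (metis card_Diff_subset card_mono finite_subset le_add_diff_inverse2)
  have "card ?H \<le> card ?S"
    using B assms by (intro card_mono) auto
  then have "2 * card ?H \<le> 2 * card ?S" by simp
  with card_large_subsets[of ?B] assms have *: "2 ^ card ?B \<le> 2 * card ?S"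
    using le_trans by blast
  have "(2::nat) ^ card A = 2 ^ card ?B * 2 ^ card Q"
    by (simp add: B[symmetric] power_add)
  also have "\<dots> \<le> (2 * card ?S) * 2 ^ l"
    using * assms by (intro mult_mono) auto
  finally show ?thesis by (simp add: mult_ac)
qed

section \<open>Independence over disjoint blocks of bits\<close>

lemma sum_Pow_Un:
  assumes "finite A" "finite B" "A \<inter> B = {}"
  shows "(\<Sum>Z\<in>Pow (A \<union> B). f (Z \<inter> A) * g (Z \<inter> B)) =
    (\<Sum>Z\<in>Pow A. f Z) * (\<Sum>Z\<in>Pow B. (g Z :: real))"
proof -
  have "(\<Sum>Z\<in>Pow A. f Z) * (\<Sum>Z\<in>Pow B. g Z) = (\<Sum>(Z, Z')\<in>Pow A \<times> Pow B. f Z * g Z')"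
    by (simp add: sum_product sum.cartesian_product)
  also have "\<dots> = (\<Sum>Z\<in>Pow (A \<union> B). f (Z \<inter> A) * g (Z \<inter> B))"
    using assms(3)
    by (intro sum.reindex_bij_witness[of _ "\<lambda>Z. (Z \<inter> A, Z \<inter> B)" "\<lambda>(Z, Z'). Z \<union> Z'"])
       (auto intro!: arg_cong2[of _ _ _ _ "(*)"] arg_cong[of _ _ f] arg_cong[of _ _ g])
  finally show ?thesis by simp
qed

text \<open>Independence of the traces of a uniform random subset on disjoint blocks, written with
  unnormalised sums.\<close>

lemma sum_Pow_UN:
  fixes f :: "'u \<Rightarrow> 'a set \<Rightarrow> real"
  assumes "finite V" "\<And>u. u \<in> V \<Longrightarrow> finite (A u)" "disjoint_family_on A V"
  shows "(\<Sum>Z\<in>Pow (\<Union>u\<in>V. A u). \<Prod>u\<in>V. f u (Z \<inter> A u)) = (\<Prod>u\<in>V. \<Sum>Z\<in>Pow (A u). f u Z)"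
  using assms
proof (induction V rule: finite_induct)
  case empty
  then show ?case by simp
next
  case (insert u V)
  let ?B = "\<Union>u\<in>V. A u"
  have disj: "A u \<inter> ?B = {}"
    using insert.prems(2) insert.hyps(2) unfolding disjoint_family_on_def by fastforce
  have IH: "(\<Sum>Z\<in>Pow ?B. \<Prod>u\<in>V. f u (Z \<inter> A u)) = (\<Prod>u\<in>V. \<Sum>Z\<in>Pow (A u). f u Z)"
    using insert by (intro insert.IH) (auto simp: disjoint_family_on_def)
  have "(\<Sum>Z\<in>Pow (\<Union>u\<in>insert u V. A u). \<Prod>u\<in>insert u V. f u (Z \<inter> A u)) =
      (\<Sum>Z\<in>Pow (A u \<union> ?B). f u (Z \<inter> A u) * (\<Prod>u\<in>V. f u ((Z \<inter> ?B) \<inter> A u)))"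
  proof (rule sum.cong)
    fix Z
    have "(\<Prod>v\<in>V. f v (Z \<inter> A v)) = (\<Prod>v\<in>V. f v ((Z \<inter> ?B) \<inter> A v))"
      by (intro prod.cong refl arg_cong[of _ _ "f _"]) auto
    then show "(\<Prod>u\<in>insert u V. f u (Z \<inter> A u)) =
        f u (Z \<inter> A u) * (\<Prod>u\<in>V. f u ((Z \<inter> ?B) \<inter> A u))"
      using insert.hyps by simp
  qed simp
  also have "\<dots> = (\<Sum>Z\<in>Pow (A u). f u Z) * (\<Sum>Z\<in>Pow ?B. \<Prod>u\<in>V. f u (Z \<inter> A u))"
    using insert disj by (intro sum_Pow_Un) auto
  finally show ?case using insert.hyps IH by simp
qed

text \<open>Every unit \<open>u\<close> with few picks \<open>Q u\<close> survives independently
  with probability at least \<open>2 powr - (l + 1)\<close>, and the survivors are counted through the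
  expectation of \<open>(1/2) ^ card\<close>.\<close>
lemma card_few_survivors:
  fixes \<theta> :: real
  assumes V: "finite V" and A: "\<And>u. u \<in> V \<Longrightarrow> finite (A u)" "disjoint_family_on A V"
    and Q: "\<And>u. u \<in> V \<Longrightarrow> Q u \<subseteq> A u" and l: "\<And>u. u \<in> V \<Longrightarrow> 2 * l \<le> card (A u)" "0 < l"
    and q: "2 * (\<Sum>u\<in>V. card (Q u)) \<le> l * card V"
    and \<theta>: "\<theta> * 2 ^ (l + 4) \<le> card V" "0 \<le> \<theta>"
  shows "card {Z. Z \<subseteq> (\<Union>u\<in>V. A u) \<and>
      card {u\<in>V. Z \<inter> Q u = {} \<and> card (A u) \<le> 4 * card (Z \<inter> A u)} < \<theta>}
    \<le> exp (- \<theta>) * 2 ^ card (\<Union>u\<in>V. A u)"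
proof -
  define G where "G = {u\<in>V. card (Q u) \<le> l}"
  define ok where "ok u Z \<longleftrightarrow> Z \<inter> Q u = {} \<and> card (A u) \<le> 4 * card Z" for u and Z :: "'b set"
  define S where "S Z = {u\<in>V. Z \<inter> Q u = {} \<and> card (A u) \<le> 4 * card (Z \<inter> A u)}" for Z
  let ?F = "\<Union>u\<in>V. A u"
  define f :: "'a \<Rightarrow> 'b set \<Rightarrow> real"
    where "f u Z = (if u \<in> G \<and> ok u Z then 1/2 else 1)" for u Z
  \<comment> \<open>Half of the bound \<open>1 / 2 ^ (l + 1)\<close> on the survival probability:
    for \<open>u\<close> in \<open>G\<close> the mean of \<open>f u\<close> is at most
    \<open>1 - x\<close>, hence at most \<open>exp (- x)\<close>.\<close>
  define x :: real where "x = 1 / 2 ^ (l + 2)"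
  have finF: "finite ?F" using V A by auto
  have GV: "G \<subseteq> V" "finite G" using V by (auto simp: G_def)
  \<comment> \<open>Markov's inequality: the average of \<open>card (Q u)\<close> is at most
    \<open>l / 2\<close>, so at most half of the units exceed \<open>l\<close>.\<close>
  have cardG: "card V \<le> 2 * card G"
  proof -
    have "card (V - G) * l = (\<Sum>u\<in>V - G. l)" by simp
    also have "\<dots> \<le> (\<Sum>u\<in>V - G. card (Q u))" by (intro sum_mono) (auto simp: G_def)
    also have "\<dots> \<le> (\<Sum>u\<in>V. card (Q u))" using V by (intro sum_mono2) auto
    finally have "2 * (card (V - G) * l) \<le> l * card V" using q by linarith
    then have "l * (2 * card (V - G)) \<le> l * card V" by (simp only: mult_ac)
    then have "2 * card (V - G) \<le> card V" using l(2) by (simp only: mult_le_cancel1)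
    moreover have "card (V - G) = card V - card G" "card G \<le> card V"
      using GV V by (auto simp: card_Diff_subset card_mono)
    ultimately show ?thesis by simp
  qed
  have factor: "(\<Sum>Z\<in>Pow (A u). f u Z) \<le> 2 ^ card (A u) * (if u \<in> G then exp (- x) else 1)"
    if u: "u \<in> V" for u
  proof (cases "u \<in> G")
    case False
    then show ?thesis using A u by (simp add: f_def card_Pow)
  next
    case True
    let ?H = "{Z. Z \<subseteq> A u \<and> Z \<inter> Q u = {} \<and> card (A u) \<le> 4 * card Z}"
    have "2 ^ card (A u) \<le> 2 ^ (l + 1) * card ?H"
      using True A Q l u by (intro card_avoiding_large_subsets) (auto simp: G_def)
    then have "real (2 ^ card (A u)) \<le> real (2 ^ (l + 1) * card ?H)" by (rule of_nat_mono)
    then have H: "2 ^ card (A u) * x \<le> card ?H / 2"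
      unfolding x_def by (simp add: field_simps)
    have "(\<Sum>Z\<in>Pow (A u). f u Z) = (\<Sum>Z\<in>Pow (A u). 1 - (1/2) * of_bool (Z \<in> ?H))"
      using True by (intro sum.cong) (auto simp: f_def ok_def)
    also have "\<dots> = 2 ^ card (A u) - (\<Sum>Z\<in>Pow (A u). (1/2) * of_bool (Z \<in> ?H))"
      using A u by (simp add: sum_subtractf card_Pow)
    also have "(\<Sum>Z\<in>Pow (A u). (1/2) * of_bool (Z \<in> ?H)) = (1/2) * real (card ?H)"
    proof -
      have "(\<Sum>Z\<in>Pow (A u). of_bool (Z \<in> ?H)) = (\<Sum>Z\<in>Pow (A u) \<inter> ?H. 1::real)"
        using A u by (subst sum.inter_restrict) (auto simp: of_bool_def)
      moreover have "Pow (A u) \<inter> ?H = ?H" by auto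
      ultimately show ?thesis by (simp only: sum_distrib_left[symmetric] sum_constant mult_1_right)
    qed
    also have "2 ^ card (A u) - (1/2) * real (card ?H) \<le> 2 ^ card (A u) * (1 - x)"
      using H by (simp add: algebra_simps)
    also have "\<dots> \<le> 2 ^ card (A u) * exp (- x)"
      using exp_ge_add_one_self[of "- x"] by (intro mult_left_mono) auto
    finally show ?thesis using True by simp
  qed
  have prodf: "(\<Prod>u\<in>V. f u (Z \<inter> A u)) = (1/2) ^ card (S Z \<inter> G)" for Z
  proof -
    have "(\<Prod>u\<in>V. f u (Z \<inter> A u)) = (\<Prod>u\<in>V. if u \<in> S Z \<inter> G then 1/2 else 1)"
      using Q by (intro prod.cong) (auto simp: f_def ok_def S_def)
    also have "\<dots> = (\<Prod>u\<in>S Z \<inter> G. 1/2)"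
    proof -
      have "V \<inter> (S Z \<inter> G) = S Z \<inter> G" using GV by auto
      then show ?thesis using prod.inter_restrict[OF V, of "\<lambda>_. 1/2" "S Z \<inter> G"] by metis
    qed
    finally show ?thesis by simp
  qed
  have "(\<Sum>Z\<in>Pow ?F. (1/2) ^ card (S Z \<inter> G)) = (\<Prod>u\<in>V. \<Sum>Z\<in>Pow (A u). f u Z)"
    using sum_Pow_UN[of V A f] V A by (simp add: prodf)
  also have "\<dots> \<le> (\<Prod>u\<in>V. 2 ^ card (A u) * (if u \<in> G then exp (- x) else 1))"
    using factor by (intro prod_mono) (auto intro!: sum_nonneg simp: f_def)
  also have "\<dots> = 2 ^ card ?F * exp (- x) ^ card G"
  proof -
    have "(\<Prod>u\<in>V. if u \<in> G then exp (- x) else 1) = (\<Prod>u\<in>V \<inter> G. exp (- x))"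
      by (rule prod.inter_restrict[OF V, symmetric])
    moreover have "card ?F = (\<Sum>u\<in>V. card (A u))"
      using V A by (intro card_UN_disjoint) (auto simp: disjoint_family_on_def)
    ultimately show ?thesis
      using GV by (simp add: prod.distrib power_sum Int_absorb1)
  qed
  \<comment> \<open>Of the factor \<open>2 ^ (l + 4)\<close>, the part \<open>2 ^ (l + 2)\<close>
    cancels \<open>x\<close>, a 2 pays for passing from \<open>V\<close> to \<open>G\<close>, and
    the last 2 gives the exponent \<open>2 * \<theta>\<close>, half of which is lost below.\<close>
  also have "exp (- x) ^ card G \<le> exp (- 2 * \<theta>)"
  proof -
    have "\<theta> * 2 ^ (l + 4) \<le> 2 * card G" using \<theta> cardG by linarith
    then have "2 * \<theta> \<le> x * card G" by (simp add: x_def power_add field_simps)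
    then show ?thesis by (simp flip: exp_of_nat_mult add: mult.commute)
  qed
  finally have main: "(\<Sum>Z\<in>Pow ?F. (1/2) ^ card (S Z \<inter> G)) \<le> 2 ^ card ?F * exp (- 2 * \<theta>)"
    by simp
  \<comment> \<open>Prepares Markov's inequality for \<open>(1/2) ^ card (S Z \<inter> G)\<close>:
    on the bad event it is at least \<open>exp (- \<theta>)\<close> because
    \<open>ln 2 \<le> 1\<close>.\<close>
  have low: "exp (- \<theta>) \<le> (1/2) ^ card (S Z \<inter> G)" if "card (S Z) < \<theta>" for Z
  proof -
    have "card (S Z \<inter> G) \<le> card (S Z)" using V by (intro card_mono) (auto simp: S_def)
    then have c: "card (S Z \<inter> G) \<le> \<theta>" using that by linarith
    have "(1/2::real) ^ card (S Z \<inter> G) = exp (- (card (S Z \<inter> G) * ln 2))"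
      by (simp add: exp_minus exp_of_nat_mult power_one_over inverse_eq_divide)
    moreover have "card (S Z \<inter> G) * ln 2 \<le> \<theta> * 1"
      using c ln2_le_25_over_36 \<theta> by (intro mult_mono) auto
    ultimately show ?thesis by simp
  qed
  let ?B = "{Z. Z \<subseteq> ?F \<and> card (S Z) < \<theta>}"
  have "card ?B * exp (- \<theta>) = (\<Sum>Z\<in>?B. exp (- \<theta>))" by simp
  also have "\<dots> \<le> (\<Sum>Z\<in>?B. (1/2) ^ card (S Z \<inter> G))"
    using low by (intro sum_mono) auto
  also have "\<dots> \<le> (\<Sum>Z\<in>Pow ?F. (1/2) ^ card (S Z \<inter> G))"
    using finF by (intro sum_mono2) auto
  also note main
  also have "2 ^ card ?F * exp (- 2 * \<theta>) = (exp (- \<theta>) * 2 ^ card ?F) * exp (- \<theta>)"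
    by (simp flip: exp_add add: mult.assoc mult.left_commute)
  finally have "card ?B \<le> exp (- \<theta>) * 2 ^ card ?F" by (simp add: mult.commute)
  then show ?thesis by (simp add: S_def)
qed

text \<open>Fubini for the uniform distribution on \<open>Pow E\<close>, when the set \<open>F X\<close> of re-randomised bits
  may itself depend on the bits outside of it.\<close>
lemma card_Pow_by_classes:
  fixes \<delta> :: real
  assumes E: "finite E" and F: "\<And>X. X \<subseteq> E \<Longrightarrow> F X \<subseteq> E"
    and cong: "\<And>X Y. X \<subseteq> E \<Longrightarrow> Y \<subseteq> E \<Longrightarrow> Y - F X = X - F X \<Longrightarrow> F Y = F X"
    and bound: "\<And>X. X \<subseteq> E \<Longrightarrow>
      card {Z. Z \<subseteq> F X \<and> P ((X - F X) \<union> Z)} \<le> \<delta> * 2 ^ card (F X)"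
  shows "card {X. X \<subseteq> E \<and> P X} \<le> \<delta> * 2 ^ card E"
proof -
  \<comment> \<open>The sets obtained from \<open>X\<close> by changing bits in \<open>F X\<close>.
    By \<open>cong\<close> all members have the same \<open>F\<close>, so the classes partition
    \<open>Pow E\<close>.\<close>
  define cl where "cl X = {Y. Y \<subseteq> E \<and> Y - F X = X - F X}" for X
  have self: "X \<in> cl X" if "X \<subseteq> E" for X using that by (simp add: cl_def)
  have cl_eq: "cl Y = cl X" if "X \<subseteq> E" "Y \<in> cl X" for X Y
    using cong[OF that(1), of Y] that by (auto simp: cl_def)
  have cl_image: "cl X = (\<lambda>Z. (X - F X) \<union> Z) ` Pow (F X)"
    and inj: "inj_on (\<lambda>Z. (X - F X) \<union> Z) (Pow (F X))" if X: "X \<subseteq> E" for X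
  proof
    show "cl X \<subseteq> (\<lambda>Z. (X - F X) \<union> Z) ` Pow (F X)"
    proof
      fix Y assume "Y \<in> cl X"
      then have "Y = (X - F X) \<union> (Y \<inter> F X)" by (auto simp: cl_def)
      then show "Y \<in> (\<lambda>Z. (X - F X) \<union> Z) ` Pow (F X)" by blast
    qed
    show "(\<lambda>Z. (X - F X) \<union> Z) ` Pow (F X) \<subseteq> cl X" using X F[OF X] by (auto simp: cl_def)
    show "inj_on (\<lambda>Z. (X - F X) \<union> Z) (Pow (F X))" by (rule inj_onI) auto
  qed
  have fin: "finite (cl X)" for X using E by (auto simp: cl_def)
  have part: "card {Y\<in>cl X. P Y} \<le> \<delta> * card (cl X)" if X: "X \<subseteq> E" for X
  proof -
    have "{Y\<in>cl X. P Y} = (\<lambda>Z. (X - F X) \<union> Z) ` {Z. Z \<subseteq> F X \<and> P ((X - F X) \<union> Z)}"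
      unfolding cl_image[OF X] by auto
    moreover have "inj_on (\<lambda>Z. (X - F X) \<union> Z) {Z. Z \<subseteq> F X \<and> P ((X - F X) \<union> Z)}"
      by (rule inj_on_subset[OF inj[OF X]]) auto
    ultimately have "card {Y\<in>cl X. P Y} = card {Z. Z \<subseteq> F X \<and> P ((X - F X) \<union> Z)}"
      by (simp add: card_image)
    moreover have "card (cl X) = 2 ^ card (F X)"
      using F[OF X] E
      unfolding cl_image[OF X] card_image[OF inj[OF X]] by (simp add: card_Pow finite_subset)
    ultimately show ?thesis using bound[OF X] by simp
  qed
  let ?K = "cl ` Pow E"
  have finK: "finite ?K" using E by simp
  have "{X. X \<subseteq> E \<and> P X} \<subseteq> (\<Union>K\<in>?K. {Y\<in>K. P Y})" using self by auto
  then have "card {X. X \<subseteq> E \<and> P X} \<le> card (\<Union>K\<in>?K. {Y\<in>K. P Y})"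
    using E fin by (intro card_mono) auto
  also have "\<dots> \<le> (\<Sum>K\<in>?K. card {Y\<in>K. P Y})" using finK by (rule card_UN_le)
  finally have "real (card {X. X \<subseteq> E \<and> P X}) \<le> real (\<Sum>K\<in>?K. card {Y\<in>K. P Y})"
    by (rule of_nat_mono)
  also have "\<dots> = (\<Sum>K\<in>?K. real (card {Y\<in>K. P Y}))" by (rule of_nat_sum)
  also have "\<dots> \<le> (\<Sum>K\<in>?K. \<delta> * card K)" using part by (intro sum_mono) auto
  also have "\<dots> = \<delta> * (\<Sum>K\<in>?K. card K)" by (simp add: sum_distrib_left)
  also have "(\<Sum>K\<in>?K. card K) = card (\<Union>?K)"
  proof (rule card_Union_disjoint[symmetric])
    show "pairwise disjnt ?K"
    proof (rule pairwiseI)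
      fix K K' assume "K \<in> ?K" "K' \<in> ?K" "K \<noteq> K'"
      then obtain X Y where XY: "X \<subseteq> E" "Y \<subseteq> E" "K = cl X" "K' = cl Y" "cl X \<noteq> cl Y" by auto
      then show "disjnt K K'"
        unfolding disjnt_def using cl_eq[OF XY(1)] cl_eq[OF XY(2)] by blast
    qed
  qed (use fin in auto)
  also have "\<Union>?K = Pow E" using self by (auto simp: cl_def)
  finally show ?thesis using E by (simp add: card_Pow)
qed

section \<open>Ranks\<close>

definition rank_in :: "('a \<Rightarrow> nat) \<Rightarrow> 'a set \<Rightarrow> 'a \<Rightarrow> nat" where
  "rank_in f P z = card {y\<in>P. f y \<le> f z}"

lemma rank_in_less_iff:
  assumes "finite P" "x \<in> P" "y \<in> P"
  shows "rank_in f P x < rank_in f P y \<longleftrightarrow> f x < f y"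
proof
  assume "f x < f y"
  then have "{z\<in>P. f z \<le> f x} \<subseteq> {z\<in>P. f z \<le> f y}"
    "y \<in> {z\<in>P. f z \<le> f y}" "y \<notin> {z\<in>P. f z \<le> f x}" using assms by auto
  then have "{z\<in>P. f z \<le> f x} \<subset> {z\<in>P. f z \<le> f y}" by blast
  then show "rank_in f P x < rank_in f P y"
    unfolding rank_in_def using assms by (intro psubset_card_mono) auto
next
  assume *: "rank_in f P x < rank_in f P y"
  show "f x < f y"
  proof (rule ccontr)
    assume "\<not> f x < f y"
    then have "rank_in f P y \<le> rank_in f P x"
      unfolding rank_in_def using assms by (intro card_mono) auto
    with * show False by simp
  qed
qed

lemma bij_betw_rank_in:
  assumes "finite P" "inj_on f P"
  shows "bij_betw (rank_in f P) P {1..card P}"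
proof -
  have "inj_on (rank_in f P) P"
  proof (rule inj_onI)
    fix x y assume xy: "x \<in> P" "y \<in> P" "rank_in f P x = rank_in f P y"
    then have "f x = f y"
      using rank_in_less_iff[OF assms(1) xy(1,2), of f] rank_in_less_iff[OF assms(1) xy(2,1), of f]
      by simp
    then show "x = y" using assms(2) xy by (simp add: inj_on_def)
  qed
  moreover have "rank_in f P ` P = {1..card P}"
  proof (rule card_subset_eq)
    show "rank_in f P ` P \<subseteq> {1..card P}"
    proof
      fix k assume "k \<in> rank_in f P ` P"
      then obtain x where x: "x \<in> P" "k = rank_in f P x" by auto
      then have "x \<in> {y\<in>P. f y \<le> f x}" by simp
      then have "0 < k" unfolding x(2) rank_in_def using assms by (subst card_gt_0_iff) auto
      moreover have "k \<le> card P" unfolding x(2) rank_in_def using assms by (intro card_mono) auto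
      ultimately show "k \<in> {1..card P}" by simp
    qed
    show "card (rank_in f P ` P) = card {1..card P}"
      using \<open>inj_on (rank_in f P) P\<close> by (simp add: card_image)
  qed simp
  ultimately show ?thesis by (simp add: bij_betw_def)
qed

text \<open>If an interval of ranks contains no splitter, the bucket around it is at least as large;
  only the sentinel \<open>N\<close> may be the right end of the interval.\<close>
lemma two_balanced_gap:
  assumes bal: "two_balanced p N rs" and lo: "0 < lo" "lo \<le> hi" "hi \<le> N"
    and gap: "\<And>x. x \<in> set rs \<Longrightarrow> x < lo \<or> hi < x"
    and p: "0 < p"
  shows "real (hi + 1 - lo) \<le> 2 * real N / real p"
proof -
  define qs where "qs = 0 # sort rs @ [N]"
  have len: "length qs = p + 1"
    using bal p by (auto simp: two_balanced_def qs_def)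
  have step: "real (qs ! Suc i) - real (qs ! i) \<le> 2 * real N / real p" if "i < p" for i
    using bal that by (auto simp: two_balanced_def qs_def Let_def)
  have last: "qs ! p = N"
    using len by (auto simp: qs_def nth_append nth_Cons')
  have ex: "\<exists>i. i \<le> p \<and> lo \<le> qs ! i" using last lo by auto
  \<comment> \<open>The first entry not below \<open>lo\<close>; its predecessor is below
    \<open>lo\<close>, so the bucket between them contains the interval.\<close>
  define i where "i = (LEAST i. i \<le> p \<and> lo \<le> qs ! i)"
  have i: "i \<le> p" "lo \<le> qs ! i" using LeastI_ex[OF ex] by (auto simp: i_def)
  have "i \<noteq> 0" using i lo by (auto simp: qs_def intro: ccontr)
  then obtain j where j: "i = Suc j" by (cases i) auto
  have less: "qs ! j < lo"
    using not_less_Least[of j "\<lambda>i. i \<le> p \<and> lo \<le> qs ! i"] i j by (auto simp: i_def)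
  have "hi \<le> qs ! i"
  proof -
    have "qs ! i \<in> set qs" using i len by (intro nth_mem) simp
    then have "qs ! i = 0 \<or> qs ! i = N \<or> qs ! i \<in> set rs" unfolding qs_def by auto
    then show ?thesis using i(2) lo gap[of "qs ! i"] by auto
  qed
  then have "real (hi + 1 - lo) \<le> real (qs ! Suc j) - real (qs ! j)"
    using less j lo(2) by (simp add: of_nat_diff)
  then show ?thesis using step[of j] i j by simp
qed

text \<open>Lexicographic comparison of two-digit numbers in base \<open>b\<close>; applied once per
  digit, it decodes \<open>key\<close>.\<close>

lemma radix_less_iff:
  fixes a a' b x x' :: nat
  assumes "x < b" "x' < b"
  shows "a * b + x < a' * b + x' \<longleftrightarrow> a < a' \<or> a = a' \<and> x < x'"
proof -
  have "a * b + x < a' * b + x'" if "a < a'" "x < b" for a a' x x' :: nat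
  proof -
    have "a * b + x < Suc a * b" using that by simp
    also have "\<dots> \<le> a' * b" using that by (intro mult_right_mono) auto
    finally show ?thesis by simp
  qed
  from this[of a a' x x'] this[of a' a x' x] show ?thesis using assms by (cases a a' rule: linorder_cases) auto
qed

section \<open>The hard inputs\<close>

text \<open>Each local memory is cut into \<open>k\<close> sections of length \<open>s\<close> (and a remainder), and the processors
  into groups of size \<open>m\<close>. A unit \<open>(c, g)\<close> consists of the sections \<open>c\<close> of the processors of
  group \<open>g\<close>; units occupy disjoint intervals of ranks that do not depend on \<open>X\<close>. Inside a unit the
  sections are sorted by their level, the number of leading one-bits. The bit \<open>(t, c, i) \<in> X\<close> tells
  whether section \<open>c\<close> of processor \<open>i\<close> stays in the window of its unit in superstep \<open>t\<close>.\<close>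
locale hard_inputs =
  fixes p n r k m s :: nat and A :: strategy and \<omega> :: nat
  assumes m_def: "m = 3 * k * 4 ^ r" and s_def: "s = n div k"
    and k_pos: "0 < k" and s_pos: "0 < s" and gap_size: "2 * n < 3 * k * s"
begin

definition lev :: "(nat \<times> nat \<times> nat) set \<Rightarrow> nat \<Rightarrow> nat \<Rightarrow> nat" where
  "lev X c i = (LEAST t. t = r \<or> (t, c, i) \<notin> X)"

text \<open>A mixed-radix number that sorts by section, group, level, processor and local position,
  in this order. Levels count only inside a unit, so \<open>X\<close> permutes ranks within units
  only.\<close>

definition key :: "(nat \<times> nat \<times> nat) set \<Rightarrow> nat \<times> nat \<Rightarrow> nat" where
  "key X z = (case z of (i, j) \<Rightarrow>
    ((((j div s) * p + i div m) * (r + 1) + lev X (j div s) i) * p + i) * n + j)"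

definition positions :: "(nat \<times> nat) set" where
  "positions = {..<p} \<times> {..<n}"

definition inp :: "(nat \<times> nat \<times> nat) set \<Rightarrow> input" where
  "inp X i j = rank_in (key X) positions (i, j)"

definition tr :: "(nat \<times> nat \<times> nat) set \<Rightarrow> nat \<Rightarrow> transcript" where
  "tr X t = run A p n \<omega> (inp X) t"

text \<open>Stored as a set of processors, since a unit has one section per processor of its group.
  For \<open>t \<le> r\<close> it depends only on the bits of supersteps before
  \<open>t\<close>.\<close>

definition win :: "(nat \<times> nat \<times> nat) set \<Rightarrow> nat \<Rightarrow> nat \<times> nat \<Rightarrow> nat set" where
  "win X t u = {i. i < p \<and> i div m = snd u \<and> t \<le> lev X (fst u) i}"

text \<open>The size bound lets the window shrink to a quarter per superstep. It is \<open>m\<close>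
  for \<open>t = 0\<close>, and \<open>3 * k\<close> sections for \<open>t = r\<close>, which by
  \<open>gap_size\<close> hold more than \<open>2 * n\<close> keys.\<close>

definition untouched :: "(nat \<times> nat \<times> nat) set \<Rightarrow> nat \<Rightarrow> (nat \<times> nat) set" where
  "untouched X t = {u. (\<forall>(i, j)\<in>sampled (tr X t). j div s = fst u \<longrightarrow> i \<notin> win X t u) \<and>
     3 * k * 4 ^ (r - t) \<le> card (win X t u)}"

text \<open>All earlier times are included, so the set decreases with \<open>t\<close> and a unit
  that was hit never regains hidden bits.\<close>

definition alive :: "(nat \<times> nat \<times> nat) set \<Rightarrow> nat \<Rightarrow> (nat \<times> nat) set" where
  "alive X t = {u. u \<in> {..<k} \<times> {..<p div m} \<and> (\<forall>t'\<le>t. u \<in> untouched X t')}"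

definition free_bits :: "nat \<Rightarrow> (nat \<times> nat) set \<Rightarrow> (nat \<times> nat \<times> nat) set" where
  "free_bits t V = {(t', c, i). t \<le> t' \<and> (c, i div m) \<in> V}"

definition picks :: "(nat \<times> nat \<times> nat) set \<Rightarrow> nat \<Rightarrow> (nat \<times> nat) set" where
  "picks X t = {(i, j). i < p \<and> j < n \<and> j \<in> A \<omega> t i (local_view n (inp X) i (tr X t)) (tr X t)}"

lemma m_pos: "0 < m" using k_pos by (simp add: m_def)

lemma le_lev_iff: "t \<le> lev X c i \<longleftrightarrow> (\<forall>t'<t. (t', c, i) \<in> X)" if "t \<le> r"
proof
  assume *: "t \<le> lev X c i"
  show "\<forall>t'<t. (t', c, i) \<in> X"
  proof (intro allI impI)
    fix t' assume "t' < t"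
    then have "t' < lev X c i" using * by simp
    then show "(t', c, i) \<in> X" unfolding lev_def by (blast dest: not_less_Least)
  qed
next
  assume *: "\<forall>t'<t. (t', c, i) \<in> X"
  have "lev X c i = r \<or> (lev X c i, c, i) \<notin> X"
    unfolding lev_def by (rule LeastI[of _ r]) simp
  then show "t \<le> lev X c i" using * that not_less by (cases "lev X c i = r") auto
qed

lemma lev_le: "lev X c i \<le> r"
  unfolding lev_def by (rule Least_le) simp

text \<open>A level below \<open>t\<close> is determined by the bits before \<open>t\<close>, on
  which both sets agree. So a level can differ only in a unit of \<open>V\<close>, with both values
  at least \<open>t\<close>.\<close>

lemma lev_agree:
  assumes agree: "X - free_bits t V = Y - free_bits t V" and t: "t \<le> r"
  shows "lev X c i = lev Y c i \<or> (c, i div m) \<in> V \<and> t \<le> lev X c i \<and> t \<le> lev Y c i"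
proof -
  have bit: "(t', c, i) \<in> X \<longleftrightarrow> (t', c, i) \<in> Y" if "t' < t \<or> (c, i div m) \<notin> V" for t'
  proof -
    have "(t', c, i) \<notin> free_bits t V" using that by (auto simp: free_bits_def)
    then show ?thesis using agree by blast
  qed
  show ?thesis
  proof (cases "(c, i div m) \<in> V")
    case False
    then show ?thesis using bit by (auto simp: lev_def)
  next
    case True
    have *: "q \<le> lev X c i \<longleftrightarrow> q \<le> lev Y c i" if "q \<le> t" for q
      using that t bit by (simp add: le_lev_iff)
    show ?thesis
    proof (cases "t \<le> lev X c i")
      case True
      then show ?thesis using * \<open>(c, i div m) \<in> V\<close> by auto
    next
      case False
      then have "lev X c i \<le> lev Y c i" "\<not> Suc (lev X c i) \<le> lev Y c i"
        using *[of "lev X c i"] *[of "Suc (lev X c i)"] by auto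
      then show ?thesis by simp
    qed
  qed
qed

lemma lev_agree_le:
  assumes "X - free_bits t V = Y - free_bits t V" "t \<le> r" "t' \<le> t"
  shows "t' \<le> lev X c i \<longleftrightarrow> t' \<le> lev Y c i"
  using lev_agree[OF assms(1,2), of c i] assms(3) by auto

section \<open>Order of the keys\<close>

lemma key_less_iff:
  assumes "(i, j) \<in> positions" "(i', j') \<in> positions"
  shows "key X (i, j) < key X (i', j') \<longleftrightarrow>
    j div s < j' div s \<or> j div s = j' div s \<and>
      (i div m < i' div m \<or> i div m = i' div m \<and>
        (lev X (j div s) i < lev X (j' div s) i' \<or> lev X (j div s) i = lev X (j' div s) i' \<and>
          (i < i' \<or> i = i' \<and> j < j')))"
proof -
  have ij: "i < p" "i' < p" "j < n" "j' < n" using assms by (auto simp: positions_def)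
  have g: "i div m < p" "i' div m < p" using ij by (auto intro: le_less_trans[OF div_le_dividend])
  have l: "lev X c i < r + 1" for c i using lev_le[of X c i] by simp
  have eq: "a * b + x = a' * b + x' \<longleftrightarrow> a = a' \<and> x = x'" if "x < b" "x' < b"
    for a a' b x x' :: nat
    using radix_less_iff[OF that, of a a'] radix_less_iff[OF that(2,1), of a' a]
    by (metis linorder_neq_iff)
  show ?thesis
    unfolding key_def prod.case
    by (simp only: radix_less_iff[OF ij(3,4)] radix_less_iff[OF ij(1,2)] radix_less_iff[OF l l]
        radix_less_iff[OF g] eq[OF ij(3,4)] eq[OF ij(1,2)] eq[OF l l] eq[OF g]) auto
qed

lemma inj_key: "inj_on (key X) positions"
proof (rule inj_onI)
  fix z z' assume "z \<in> positions" "z' \<in> positions" "key X z = key X z'"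
  moreover obtain i j i' j' where "z = (i, j)" "z' = (i', j')" by (cases z; cases z')
  ultimately have "(i, j) \<in> positions" "(i', j') \<in> positions"
    "\<not> key X (i, j) < key X (i', j')" "\<not> key X (i', j') < key X (i, j)" and
    z: "z = (i, j)" "z' = (i', j')" by auto
  then show "z = z'"
    by (simp only: key_less_iff) (metis linorder_neq_iff)
qed

lemma finite_positions: "finite positions" by (simp add: positions_def)

lemma bij_inp: "bij_betw (\<lambda>(i, j). inp X i j) positions {1..p * n}"
proof -
  have "(\<lambda>(i, j). inp X i j) = rank_in (key X) positions" by (auto simp: inp_def)
  moreover have "card positions = p * n" by (simp add: positions_def)
  ultimately show ?thesis using bij_betw_rank_in[OF finite_positions inj_key, of X] by simp
qed

lemma inp_less_iff:
  assumes "(i, j) \<in> positions" "(i', j') \<in> positions"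
  shows "inp X i j < inp X i' j' \<longleftrightarrow> key X (i, j) < key X (i', j')"
  unfolding inp_def by (rule rank_in_less_iff[OF finite_positions assms])

text \<open>Inside one processor, sections come first and each section has a single level, so the
  order is that of the positions for every \<open>X\<close>. Local comparisons reveal
  nothing.\<close>

lemma inp_local_less_iff:
  assumes "(i, j) \<in> positions" "(i, j') \<in> positions"
  shows "inp X i j < inp X i j' \<longleftrightarrow> j < j'"
proof -
  have "(a < b \<or> a = b \<and> (i div m < i div m \<or> i div m = i div m \<and>
      (l a < l b \<or> l a = l b \<and> (i < i \<or> i = i \<and> j < j')))) \<longleftrightarrow> j < j'"
    if "j \<le> j' \<Longrightarrow> a \<le> b" "j' \<le> j \<Longrightarrow> b \<le> a" for a b and l :: "nat \<Rightarrow> nat"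
    using that by (cases "j < j'") auto
  from this[of "j div s" "j' div s" "\<lambda>c. lev X c i"] show ?thesis
    unfolding inp_less_iff[OF assms] key_less_iff[OF assms] by (simp add: div_le_mono)
qed

lemma valid_inp: "0 < p \<Longrightarrow> valid_input p (p * n) (inp X)"
  using bij_inp[of X] by (simp add: valid_input_def positions_def)


text \<open>The level of \<open>(i', j')\<close> is fixed by the agreed bits, and is below
  \<open>t\<close> in a unit of \<open>V\<close>. A key of the same unit whose level may change has
  level at least \<open>t\<close> for both \<open>X\<close> and \<open>Y\<close>, hence lies above
  it either way.\<close>

lemma key_less_agree:
  assumes agree: "X - free_bits t V = Y - free_bits t V" and t: "t \<le> r"
    and z: "(i, j) \<in> positions" "(i', j') \<in> positions"
    and low: "(j' div s, i' div m) \<in> V \<Longrightarrow> \<not> t \<le> lev X (j' div s) i'"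
  shows "key X (i, j) < key X (i', j') \<longleftrightarrow> key Y (i, j) < key Y (i', j')"
    and "key X (i', j') < key X (i, j) \<longleftrightarrow> key Y (i', j') < key Y (i, j)"
proof -
  have 1: "lev X c i = lev Y c i \<or> (c, i div m) \<in> V \<and> t \<le> lev X c i \<and> t \<le> lev Y c i" for c i
    by (rule lev_agree[OF agree t])
  have 2: "lev X (j' div s) i' = lev Y (j' div s) i'"
    using 1[of "j' div s" i'] low by auto
  have *: "lev X (j div s) i = lev Y (j div s) i \<or>
      lev X (j' div s) i' < lev X (j div s) i \<and> lev Y (j' div s) i' < lev Y (j div s) i"
    if "j div s = j' div s" "i div m = i' div m"
    using 1[of "j div s" i] 2 low that by auto
  show "key X (i, j) < key X (i', j') \<longleftrightarrow> key Y (i, j) < key Y (i', j')"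
    unfolding key_less_iff[OF z] using * 2 by (smt (verit) less_asym less_irrefl)
  show "key X (i', j') < key X (i, j) \<longleftrightarrow> key Y (i', j') < key Y (i, j)"
    unfolding key_less_iff[OF z(2,1)] using * 2 by (smt (verit) less_asym less_irrefl)
qed

lemma inp_agree:
  assumes "X - free_bits t V = Y - free_bits t V" "t \<le> r" "(i', j') \<in> positions"
    and "(j' div s, i' div m) \<in> V \<Longrightarrow> \<not> t \<le> lev X (j' div s) i'"
  shows "inp X i' j' = inp Y i' j'"
proof -
  have "{z\<in>positions. key X z \<le> key X (i', j')} = {z\<in>positions. key Y z \<le> key Y (i', j')}"
    using key_less_agree(2)[OF assms(1,2) _ assms(3,4)] by (auto simp: not_less[symmetric])
  then show ?thesis by (simp add: inp_def rank_in_def)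
qed

section \<open>The transcript of a hard input\<close>

lemma tr_0 [simp]: "tr X 0 = []" by (simp add: tr_def)

lemma tr_Suc: "tr X (Suc t) = tr X t @ [(\<lambda>(i, j). (i, j, inp X i j)) ` picks X t]"
  by (auto simp: tr_def picks_def step_samples_def Let_def image_def)

lemma sampled_Nil [simp]: "sampled [] = {}" by (simp add: sampled_def)

lemma sampled_Suc: "sampled (tr X (Suc t)) = sampled (tr X t) \<union> picks X t"
  by (auto simp: tr_Suc sampled_def)

lemma picks_positions: "picks X t \<subseteq> positions" by (auto simp: picks_def positions_def)

lemma sampled_positions: "sampled (tr X t) \<subseteq> positions"
  using picks_positions by (induction t) (simp_all add: sampled_Suc)

lemma tranks_sampled: "tranks (tr X t) = (\<lambda>(i, j). inp X i j) ` sampled (tr X t)"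
proof (induction t)
  case 0
  then show ?case by (simp add: tranks_def)
next
  case (Suc t)
  have "tranks (T @ [S]) = tranks T \<union> (\<lambda>(i, j, x). x) ` S" for T S
    unfolding tranks_def by force
  then show ?case
    unfolding sampled_Suc image_Un by (simp add: Suc tr_Suc image_image case_prod_beta)
qed

lemma alive_Suc: "alive X (Suc t) = alive X t \<inter> untouched X (Suc t)"
  by (auto simp: alive_def le_Suc_eq)

lemma alive_untouched: "u \<in> alive X t \<Longrightarrow> u \<in> untouched X t"
  by (simp add: alive_def)

text \<open>Supplies the premise \<open>low\<close> of \<open>key_less_agree\<close>: samples in an
  alive unit lie below its window.\<close>

lemma sampled_alive_low:
  assumes "(i, j) \<in> sampled (tr X t)" "(j div s, i div m) \<in> alive X t"
  shows "\<not> t \<le> lev X (j div s) i"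
proof -
  have "i < p" using assms(1) sampled_positions[of X t] by (auto simp: positions_def)
  moreover have "i \<notin> win X t (j div s, i div m)"
    using assms(1) alive_untouched[OF assms(2)] by (force simp: untouched_def)
  ultimately show ?thesis by (simp add: win_def)
qed

text \<open>A processor sees the transcript, its local order, which is constant, and comparisons
  with published ranks. Those belong to sampled keys, so the free bits do not affect the
  comparisons.\<close>

lemma picks_agree:
  assumes agree: "X - free_bits t (alive X t) = Y - free_bits t (alive X t)" and t: "t \<le> r"
    and tr: "tr Y t = tr X t"
  shows "picks Y t = picks X t"
proof -
  have "local_view n (inp X) i (tr X t) = local_view n (inp Y) i (tr X t)" if i: "i < p" for i
  proof -
    have loc: "inp X i j < inp X i j' \<longleftrightarrow> inp Y i j < inp Y i j'" if "j < n" "j' < n" for j j'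
      using that i by (simp add: inp_local_less_iff positions_def)
    have glob: "inp X i j < x \<longleftrightarrow> inp Y i j < x" if j: "j < n" and x: "x \<in> tranks (tr X t)" for j x
    proof -
      obtain i' j' where *: "(i', j') \<in> sampled (tr X t)" "x = inp X i' j'"
        using x unfolding tranks_sampled by auto
      have P: "(i, j) \<in> positions" "(i', j') \<in> positions"
        using i j * sampled_positions[of X t] by (auto simp: positions_def)
      have "x = inp Y i' j'"
        using inp_agree[OF agree t P(2) sampled_alive_low[OF *(1)]] * by simp
      then show ?thesis
        using key_less_agree(1)[OF agree t P sampled_alive_low[OF *(1)]] *(2)
        by (simp flip: inp_less_iff[OF P])
    qed
    show ?thesis
      unfolding local_view_def using loc glob by (intro arg_cong2[of _ _ _ _ Pair] ext) blast+
  qed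
  then show ?thesis by (simp add: picks_def tr cong: conj_cong)
qed

lemma win_agree:
  assumes "X - free_bits t V = Y - free_bits t V" "t \<le> r"
  shows "win Y t u = win X t u"
  unfolding win_def by (simp only: lev_agree_le[OF assms order_refl])

text \<open>The algorithm cannot see the bits \<open>t, t + 1, \<dots>\<close> of a unit that is alive after
  \<open>t\<close> supersteps.\<close>
lemma run_agree:
  assumes "X - free_bits t (alive X t) = Y - free_bits t (alive X t)" "t \<le> r"
  shows "tr Y t = tr X t \<and> alive Y t = alive X t"
  using assms
proof (induction t)
  case 0
  then show ?case by (auto simp: alive_def untouched_def win_def)
next
  case (Suc t)
  let ?t = "Suc t"
  \<comment> \<open>A unit that dies exposes its bits, so agreement at \<open>Suc t\<close> is
    stronger than agreement at \<open>t\<close>.\<close>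
  have "free_bits ?t (alive X ?t) \<subseteq> free_bits t (alive X t)"
    by (auto simp: free_bits_def alive_Suc)
  then have agree: "X - free_bits t (alive X t) = Y - free_bits t (alive X t)"
    using Suc.prems(1) by blast
  have IH: "tr Y t = tr X t" "alive Y t = alive X t" using Suc.IH[OF agree] Suc.prems(2) by auto
  have picks: "picks Y t = picks X t" using picks_agree[OF agree _ IH(1)] Suc.prems(2) by simp
  \<comment> \<open>A new sample that stays in the window after bit \<open>t\<close> kills its unit.
    In units alive at \<open>Suc t\<close> the new samples thus lie below the window, and all new
    ranks are fixed.\<close>
  have "inp X i j = inp Y i j" if "(i, j) \<in> picks X t" for i j
    using that picks_positions sampled_alive_low[of i j X ?t]
    by (intro inp_agree[OF Suc.prems]) (auto simp: sampled_Suc)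
  then have tr: "tr Y ?t = tr X ?t" by (auto simp: tr_Suc IH picks intro!: image_cong)
  then have "untouched Y ?t = untouched X ?t"
    by (simp only: untouched_def win_agree[OF Suc.prems])
  then show ?case using tr IH by (simp add: alive_Suc)
qed

end

section \<open>One superstep\<close>

text \<open>Bounds the inverse proportion of alive units. With \<open>l = a * growth a t\<close>,
  the factor \<open>2 ^ (l + 4)\<close> is the loss in \<open>card_few_survivors\<close>.\<close>

fun growth :: "nat \<Rightarrow> nat \<Rightarrow> nat" where
  "growth a 0 = 1"
| "growth a (Suc t) = growth a t * 2 ^ (a * growth a t + 4)"

lemma growth_pos: "0 < growth a t"
  by (induction t) auto

lemma growth_mono: "t \<le> t' \<Longrightarrow> growth a t \<le> growth a t'"
  by (rule lift_Suc_mono_le) auto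

text \<open>While at least \<open>1 / growth a t\<close> of the units are alive, half of those alive receive at most
  \<open>a * growth a t\<close> samples each; this yields the recursion for \<open>growth\<close>.\<close>
locale hard_instance = hard_inputs +
  fixes C a :: nat
  assumes a_def: "a = 12 * C * 4 ^ r" and C_pos: "0 < C" and k_def: "k = a * growth a r"
    and m_le: "m \<le> p" and budget: "\<And>X t. t < r \<Longrightarrow> card (picks X t) \<le> C * p"
begin

definition bits :: "(nat \<times> nat \<times> nat) set" where
  "bits = {..<r} \<times> {..<k} \<times> {..<p}"

definition units :: nat where
  "units = k * (p div m)"

definition unit_bits :: "nat \<Rightarrow> (nat \<times> nat \<times> nat) set \<Rightarrow> nat \<times> nat \<Rightarrow> (nat \<times> nat \<times> nat) set" where
  "unit_bits t X u = (\<lambda>i. (t, fst u, i)) ` win X t u"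

definition unit_picks :: "nat \<Rightarrow> (nat \<times> nat \<times> nat) set \<Rightarrow> nat \<times> nat \<Rightarrow> (nat \<times> nat \<times> nat) set" where
  "unit_picks t X u = (\<lambda>i. (t, fst u, i)) ` {i\<in>win X t u. \<exists>j. (i, j) \<in> picks X t \<and> j div s = fst u}"

section \<open>Counting units and samples\<close>

lemma a_pos: "0 < a"
  using C_pos by (simp add: a_def)

lemma finite_alive: "finite (alive X t)"
  by (rule finite_subset[of _ "{..<k} \<times> {..<p div m}"]) (auto simp: alive_def)

lemma finite_win: "finite (win X t u)"
  by (rule finite_subset[of _ "{..<p}"]) (auto simp: win_def)

lemma card_unit_bits: "card (unit_bits t X u) = card (win X t u)"
  unfolding unit_bits_def by (rule card_image) (auto intro: inj_onI)

lemma unit_picks_subset: "unit_picks t X u \<subseteq> unit_bits t X u"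
  by (auto simp: unit_picks_def unit_bits_def)

lemma disjoint_unit_bits: "disjoint_family_on (unit_bits t X) V"
  by (auto simp: disjoint_family_on_def unit_bits_def win_def prod_eq_iff)

text \<open>Each sample touches one section, hence at most one bit, and different units have
  disjoint bits.\<close>

lemma sum_card_unit_picks:
  assumes "t < r"
  shows "(\<Sum>u\<in>alive X t. card (unit_picks t X u)) \<le> C * p"
proof -
  have fin: "finite (unit_picks t X u)" for u
    using finite_win by (simp add: unit_picks_def)
  have fin': "finite (picks X t)"
    using picks_positions finite_positions by (rule finite_subset)
  have "(\<Sum>u\<in>alive X t. card (unit_picks t X u)) = card (\<Union>u\<in>alive X t. unit_picks t X u)"
  proof (rule card_UN_disjoint[symmetric])
    show "\<forall>u\<in>alive X t. \<forall>v\<in>alive X t. u \<noteq> v \<longrightarrow> unit_picks t X u \<inter> unit_picks t X v = {}"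
      using disjoint_unit_bits[of t X UNIV] unit_picks_subset
      unfolding disjoint_family_on_def by blast
  qed (use fin finite_alive in auto)
  also have "\<dots> \<le> card ((\<lambda>(i, j). (t, j div s, i)) ` picks X t)"
    by (rule card_mono) (use fin' in \<open>force simp: unit_picks_def\<close>)+
  also have "\<dots> \<le> card (picks X t)" by (rule card_image_le[OF fin'])
  finally show ?thesis using budget[OF assms, of X] by linarith
qed

lemma p_le: "p \<le> 2 * (m * (p div m))"
proof -
  have "1 \<le> p div m" using m_le m_pos by (simp add: div_greater_zero_iff Suc_le_eq)
  then have "m \<le> m * (p div m)" by simp
  moreover have "p < m * (p div m) + m" using dividend_less_times_div[OF m_pos, of p] by simp
  ultimately show ?thesis by linarith
qed

lemma p_le_units: "p \<le> 6 * 4 ^ r * units"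
proof -
  have "2 * (m * (p div m)) = 6 * 4 ^ r * units"
    unfolding units_def using m_def by (simp add: mult.assoc mult.left_commute)
  then show ?thesis using p_le by (simp only:)
qed

text \<open>This explains the value of \<open>a\<close>: a superstep places on average at most
  \<open>a / 2\<close> samples per unit.\<close>

lemma budget_le: "2 * (C * p) \<le> a * units"
proof -
  have "2 * (C * p) \<le> 2 * (C * (6 * 4 ^ r * units))"
    by (intro mult_le_mono2 p_le_units)
  also have "\<dots> = a * units" by (simp add: a_def)
  finally show ?thesis .
qed

text \<open>With the bits outside \<open>F\<close> fixed, the windows and samples of superstep
  \<open>t\<close> are fixed, and an alive unit survives if its fresh bits in \<open>Z\<close> drop
  all sampled sections and keep a quarter of the window. Then \<open>card_few_survivors\<close>
  applies.\<close>

lemma superstep: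
  fixes X t
  defines "F \<equiv> \<Union>u\<in>alive X t. unit_bits t X u"
  assumes t: "t < r" and many: "units \<le> growth a t * card (alive X t)"
  shows "card {Z. Z \<subseteq> F \<and> growth a (Suc t) * card (alive ((X - F) \<union> Z) (Suc t)) < units}
    \<le> exp (- (units / growth a (Suc t))) * 2 ^ card F"
proof -
  let ?V = "alive X t" and ?l = "a * growth a t" and ?\<theta> = "units / growth a (Suc t)"
  define S where "S Z = {u\<in>?V. Z \<inter> unit_picks t X u = {} \<and>
    card (unit_bits t X u) \<le> 4 * card (Z \<inter> unit_bits t X u)}" for Z
  have tr: "t \<le> r" "Suc t \<le> r" using t by auto
  have F_free: "F \<subseteq> free_bits t ?V"
    by (auto simp: F_def unit_bits_def free_bits_def win_def)
  have S_alive: "S Z \<subseteq> alive ((X - F) \<union> Z) (Suc t)" if Z: "Z \<subseteq> F" for Z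
  proof
    fix u assume u: "u \<in> S Z"
    define Y where "Y = (X - F) \<union> Z"
    have agree: "X - free_bits t ?V = Y - free_bits t ?V"
      using Z F_free by (auto simp: Y_def)
    have Y: "tr Y t = tr X t" "alive Y t = ?V" "picks Y t = picks X t" "win Y t u = win X t u"
      using run_agree[OF agree tr(1)] picks_agree[OF agree tr(1)] win_agree[OF agree tr(1)] by auto
    have uV: "u \<in> ?V" using u by (simp add: S_def)
    have "win Y (Suc t) u = {i\<in>win Y t u. (t, fst u, i) \<in> Y}"
      using tr by (auto simp: win_def le_lev_iff less_Suc_eq)
    also have "\<dots> = {i\<in>win X t u. (t, fst u, i) \<in> Z}"
    proof -
      have "(t, fst u, i) \<in> Y \<longleftrightarrow> (t, fst u, i) \<in> Z" if "i \<in> win X t u" for i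
        using that uV Z by (auto simp: Y_def F_def unit_bits_def)
      then show ?thesis unfolding Y(4) by blast
    qed
    finally have win: "win Y (Suc t) u = {i\<in>win X t u. (t, fst u, i) \<in> Z}" .
    have "Z \<inter> unit_bits t X u = (\<lambda>i. (t, fst u, i)) ` win Y (Suc t) u"
      by (auto simp: win unit_bits_def)
    then have "card (Z \<inter> unit_bits t X u) = card (win Y (Suc t) u)"
      by (simp add: card_image inj_on_def)
    then have "card (win X t u) \<le> 4 * card (win Y (Suc t) u)"
      using u by (simp add: S_def card_unit_bits)
    moreover have "3 * k * 4 ^ (r - t) \<le> card (win X t u)"
      using alive_untouched[OF uV] by (simp add: untouched_def)
    moreover have "3 * k * 4 ^ (r - t) = 4 * (3 * k * 4 ^ (r - Suc t))"
      using t by (simp add: Suc_diff_Suc[symmetric])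
    ultimately have large: "3 * k * 4 ^ (r - Suc t) \<le> card (win Y (Suc t) u)" by linarith
    have "i \<notin> win Y (Suc t) u" if ij: "(i, j) \<in> sampled (tr Y (Suc t))" "j div s = fst u" for i j
    proof
      assume "i \<in> win Y (Suc t) u"
      then have i: "i \<in> win X t u" "(t, fst u, i) \<in> Z" by (auto simp: win)
      from ij(1) consider "(i, j) \<in> sampled (tr X t)" | "(i, j) \<in> picks X t"
        by (auto simp: sampled_Suc Y)
      then show False
      proof cases
        case 1
        then show False using alive_untouched[OF uV] ij(2) i by (auto simp: untouched_def)
      next
        case 2
        then have "(t, fst u, i) \<in> unit_picks t X u" using ij(2) i by (auto simp: unit_picks_def)
        then show False using u i by (auto simp: S_def)
      qed
    qed
    then have "u \<in> untouched Y (Suc t)" using large by (auto simp: untouched_def)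
    then show "u \<in> alive ((X - F) \<union> Z) (Suc t)" using uV Y by (simp add: alive_Suc flip: Y_def)
  qed
  have "{Z. Z \<subseteq> F \<and> growth a (Suc t) * card (alive ((X - F) \<union> Z) (Suc t)) < units}
      \<subseteq> {Z. Z \<subseteq> F \<and> card (S Z) < ?\<theta>}"
  proof safe
    fix Z assume Z: "Z \<subseteq> F" and less: "growth a (Suc t) * card (alive ((X - F) \<union> Z) (Suc t)) < units"
    have "card (S Z) \<le> card (alive ((X - F) \<union> Z) (Suc t))"
      by (intro card_mono finite_alive S_alive Z)
    then have "growth a (Suc t) * card (S Z) < units"
      using less by (meson le_less_trans mult_le_mono2)
    then have "real (growth a (Suc t) * card (S Z)) < real units" by (simp only: of_nat_less_iff)
    then show "card (S Z) < ?\<theta>"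
      using growth_pos[of a "Suc t"] by (simp only: of_nat_mult pos_less_divide_eq of_nat_0_less_iff mult.commute)
  qed
  then have "card {Z. Z \<subseteq> F \<and> growth a (Suc t) * card (alive ((X - F) \<union> Z) (Suc t)) < units}
      \<le> card {Z. Z \<subseteq> F \<and> card (S Z) < ?\<theta>}"
    by (rule card_mono[rotated]) (auto simp: F_def finite_alive finite_win unit_bits_def)
  also have "real (card {Z. Z \<subseteq> F \<and> card (S Z) < ?\<theta>}) \<le> exp (- ?\<theta>) * 2 ^ card F"
    unfolding F_def S_def
  proof (rule card_few_survivors)
    \<comment> \<open>The choice \<open>k = a * growth a r\<close> ensures
      \<open>?l \<le> k\<close>, and a window keeps at least \<open>3 * k\<close> sections.\<close>
    show "2 * ?l \<le> card (unit_bits t X u)" if "u \<in> ?V" for u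
    proof -
      have "?l \<le> k" using growth_mono[of t r a] t by (simp add: k_def)
      moreover have "3 * k * 1 \<le> 3 * k * 4 ^ (r - t)" by (intro mult_left_mono) auto
      ultimately have "2 * ?l \<le> 3 * k * 4 ^ (r - t)" by linarith
      then show ?thesis
        using alive_untouched[OF that] by (simp add: untouched_def card_unit_bits)
    qed
    show "2 * (\<Sum>u\<in>?V. card (unit_picks t X u)) \<le> ?l * card ?V"
    proof -
      have "2 * (\<Sum>u\<in>?V. card (unit_picks t X u)) \<le> a * units"
        using sum_card_unit_picks[OF t, of X] budget_le by linarith
      also have "\<dots> \<le> ?l * card ?V" using many by (simp add: mult.assoc)
      finally show ?thesis .
    qed
    show "?\<theta> * 2 ^ (?l + 4) \<le> card ?V"
    proof -
      have "real units \<le> real (growth a t * card ?V)" using many by (rule of_nat_mono)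
      then show ?thesis using growth_pos[of a t] by (simp add: divide_le_eq mult.commute)
    qed
    show "finite (unit_bits t X u)" for u using finite_win by (simp add: unit_bits_def)
  qed (simp_all add: finite_alive disjoint_unit_bits a_pos growth_pos unit_picks_subset)
  finally show ?thesis by simp
qed

lemma finite_bits: "finite bits" by (simp add: bits_def)

text \<open>Fubini over the classes of \<open>card_Pow_by_classes\<close>. By
  \<open>run_agree\<close> the set of fresh bits is determined by the other bits, and the first
  condition is constant on a class.\<close>

lemma card_superstep_fails:
  assumes t: "t < r"
  shows "card {X. X \<subseteq> bits \<and> units \<le> growth a t * card (alive X t) \<and>
      growth a (Suc t) * card (alive X (Suc t)) < units}
    \<le> exp (- (units / growth a (Suc t))) * 2 ^ card bits"
proof (rule card_Pow_by_classes[where F = "\<lambda>X. \<Union>u\<in>alive X t. unit_bits t X u"])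
  let ?F = "\<lambda>X. \<Union>u\<in>alive X t. unit_bits t X u"
  have same: "alive Y t = alive X t \<and> ?F Y = ?F X" if "Y - ?F X = X - ?F X" for X Y
  proof -
    have "?F X \<subseteq> free_bits t (alive X t)"
      by (auto simp: unit_bits_def free_bits_def win_def)
    then have agree: "X - free_bits t (alive X t) = Y - free_bits t (alive X t)"
      using that by blast
    have "t \<le> r" using t by simp
    then show ?thesis using run_agree[OF agree] win_agree[OF agree] by (simp add: unit_bits_def)
  qed
  show "?F X \<subseteq> bits" for X
    using t by (auto simp: unit_bits_def win_def bits_def alive_def)
  show "?F Y = ?F X" if "Y - ?F X = X - ?F X" for X Y using same[OF that] ..
  fix X
  let ?P = "\<lambda>Y. units \<le> growth a t * card (alive Y t) \<and>
    growth a (Suc t) * card (alive Y (Suc t)) < units"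
  show "card {Z. Z \<subseteq> ?F X \<and> ?P (X - ?F X \<union> Z)}
      \<le> exp (- (units / growth a (Suc t))) * 2 ^ card (?F X)"
  proof (cases "units \<le> growth a t * card (alive X t)")
    case True
    have "card {Z. Z \<subseteq> ?F X \<and> ?P (X - ?F X \<union> Z)} \<le>
        card {Z. Z \<subseteq> ?F X \<and> growth a (Suc t) * card (alive (X - ?F X \<union> Z) (Suc t)) < units}"
      by (rule card_mono) (auto simp: finite_alive finite_win unit_bits_def)
    then show ?thesis using superstep[OF t True] by linarith
  next
    case False
    have "alive (X - ?F X \<union> Z) t = alive X t" if "Z \<subseteq> ?F X" for Z
      using same[of "X - ?F X \<union> Z" X] that by auto
    then have "{Z. Z \<subseteq> ?F X \<and> ?P (X - ?F X \<union> Z)} = {}" using False by auto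
    then show ?thesis by (simp only: card.empty of_nat_0) simp
  qed
qed (rule finite_bits)

section \<open>First and last windows\<close>

lemma card_win_0: "card (win X 0 u) = m" if "snd u < p div m"
proof -
  have "m * Suc (snd u) \<le> m * (p div m)" using that by (intro mult_le_mono2) simp
  then have le: "m * snd u + m \<le> p" using times_div_less_eq_dividend[of m p] by (simp del: times_div_less_eq_dividend)
  have div: "i div m = snd u \<longleftrightarrow> m * snd u \<le> i \<and> i < m * snd u + m" for i
  proof
    assume eq: "i div m = snd u"
    show "m * snd u \<le> i \<and> i < m * snd u + m"
      using times_div_less_eq_dividend[of m i] dividend_less_times_div[OF m_pos, of i]
      unfolding eq by simp
  next
    assume "m * snd u \<le> i \<and> i < m * snd u + m"
    then show "i div m = snd u" by (intro div_nat_eqI) simp_all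
  qed
  have "win X 0 u = {m * snd u..<m * snd u + m}"
    unfolding win_def div using le by auto
  then show ?thesis by simp
qed

lemma alive_0: "alive X 0 = {..<k} \<times> {..<p div m}"
proof -
  have "u \<in> untouched X 0" if "snd u < p div m" for u
  proof -
    have "3 * k * 4 ^ (r - 0) \<le> card (win X 0 u)" using card_win_0[OF that, of X] m_def by simp
    then show ?thesis by (simp add: untouched_def)
  qed
  then show ?thesis by (auto simp: alive_def)
qed

text \<open>Union bound over the superstep in which the count first drops below its target;
  \<open>growth a r\<close> gives the weakest of the bounds and serves for all of them.\<close>

lemma card_few_alive:
  assumes "t \<le> r"
  shows "card {X. X \<subseteq> bits \<and> growth a t * card (alive X t) < units}
    \<le> t * exp (- (units / growth a r)) * 2 ^ card bits"
  using assms
proof (induction t)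
  case 0
  then show ?case by (simp add: alive_0 units_def card_cartesian_product)
next
  case (Suc t)
  let ?bad = "\<lambda>t. {X. X \<subseteq> bits \<and> growth a t * card (alive X t) < units}"
  let ?new = "{X. X \<subseteq> bits \<and> units \<le> growth a t * card (alive X t) \<and>
      growth a (Suc t) * card (alive X (Suc t)) < units}"
  have "?bad (Suc t) \<subseteq> ?bad t \<union> ?new" by (auto simp del: growth.simps)
  then have "card (?bad (Suc t)) \<le> card (?bad t \<union> ?new)"
    by (rule card_mono[rotated]) (simp add: finite_bits)
  also have "\<dots> \<le> card (?bad t) + card ?new" by (rule card_Un_le)
  finally have "real (card (?bad (Suc t))) \<le> real (card (?bad t)) + real (card ?new)"
    by (simp only: of_nat_add[symmetric] of_nat_le_iff)
  also have "\<dots> \<le> t * exp (- (units / growth a r)) * 2 ^ card bits +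
      exp (- (units / growth a (Suc t))) * 2 ^ card bits"
    using Suc card_superstep_fails[of t] by (intro add_mono) auto
  also have "exp (- (units / growth a (Suc t))) \<le> exp (- (units / growth a r))"
    using growth_mono[OF Suc.prems, of a] growth_pos[of a "Suc t"]
    by (simp del: growth.simps add: frac_le)
  finally show ?case by (simp add: algebra_simps)
qed

text \<open>The final window holds at least \<open>3 * k * s > 2 * n\<close> keys, consecutive in
  rank, and no sample. Splitters are samples, so one bucket is too large.\<close>

lemma alive_imp_failure:
  assumes u: "u \<in> alive X r"
  shows "\<not> success A out p (p * n) r (inp X) \<omega>"
proof
  assume succ: "success A out p (p * n) r (inp X) \<omega>"
  have p_pos: "0 < p" using m_le m_pos by linarith
  then have np: "p * n div p = n" by simp
  define sp where "sp = out \<omega> (tr X r)"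
  have sp: "set sp \<subseteq> sampled (tr X r)" and bal: "two_balanced p (p * n) (map (\<lambda>(i, j). inp X i j) sp)"
    using succ by (auto simp: success_def Let_def np sp_def tr_def)
  define W where "W = {(i, j). i \<in> win X r u \<and> j < n \<and> j div s = fst u}"
  define R where "R = (\<lambda>(i, j). inp X i j) ` W"
  have un: "u \<in> untouched X r" by (rule alive_untouched[OF u])
  have W_pos: "W \<subseteq> positions" by (auto simp: W_def positions_def win_def)
  have finW: "finite W" using W_pos finite_positions by (rule finite_subset)
  \<comment> \<open>Units are intervals of ranks, and the final window consists of the keys of
    highest level in its unit, so it is an interval too.\<close>
  have W_convex: "z \<in> W" if z: "z \<in> positions" "w \<in> W" "w' \<in> W" "\<not> key X z < key X w" "\<not> key X w' < key X z"
    for z w w'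
  proof -
    obtain i j i1 j1 i2 j2 where eq: "z = (i, j)" "w = (i1, j1)" "w' = (i2, j2)"
      by (metis surj_pair)
    have P: "(i, j) \<in> positions" "(i1, j1) \<in> positions" "(i2, j2) \<in> positions"
      using z W_pos eq by auto
    have W: "j1 div s = fst u" "j2 div s = fst u" "i1 div m = snd u" "i2 div m = snd u"
      "r \<le> lev X (fst u) i1" using z eq by (auto simp: W_def win_def)
    have 1: "\<not> key X (i, j) < key X (i1, j1)" "\<not> key X (i2, j2) < key X (i, j)" using z eq by auto
    have sec: "j div s = fst u"
      using 1 W unfolding key_less_iff[OF P(1,2)] key_less_iff[OF P(3,1)] by linarith
    moreover have grp: "i div m = snd u"
      using 1 W sec unfolding key_less_iff[OF P(1,2)] key_less_iff[OF P(3,1)] by linarith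
    moreover have "r \<le> lev X (fst u) i"
      using 1(1) W sec grp unfolding key_less_iff[OF P(1,2)] by auto
    ultimately show ?thesis using P(1) by (simp add: eq W_def win_def positions_def)
  qed
  have "3 * k * s \<le> card (win X r u \<times> {fst u * s..<fst u * s + s})"
    using un by (auto simp: untouched_def card_cartesian_product)
  also have "\<dots> \<le> card W"
  proof (rule card_mono[OF finW])
    have "Suc (fst u) * s \<le> k * s" using u by (intro mult_le_mono1) (auto simp: alive_def)
    also have "\<dots> \<le> n" by (simp add: s_def)
    finally have "fst u * s + s \<le> n" by simp
    then show "win X r u \<times> {fst u * s..<fst u * s + s} \<subseteq> W"
      by (auto simp: W_def mult.commute intro!: div_nat_eqI)
  qed
  also have "card W = card R"
    unfolding R_def
    by (rule card_image[symmetric], rule inj_on_subset[OF _ W_pos]) (rule bij_betw_imp_inj_on[OF bij_inp])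
  finally have cardR: "3 * k * s \<le> card R" .
  then have "R \<noteq> {}" using k_pos s_pos by auto
  moreover have "finite R" using finW by (simp add: R_def)
  ultimately have MM: "Min R \<in> R" "Max R \<in> R" "R \<subseteq> {Min R..Max R}" "Min R \<le> Max R"
    by (auto simp: Min_le_iff intro: Min_le Max_ge order_trans[OF Min_le Max_ge])
  have "R \<subseteq> {1..p * n}"
    using bij_betw_imp_surj_on[OF bij_inp, of X] W_pos by (auto simp: R_def)
  then have range: "0 < Min R" "Max R \<le> p * n" using MM by auto
  have gap: "x < Min R \<or> Max R < x" if x_in: "x \<in> set (map (\<lambda>(i, j). inp X i j) sp)" for x
  proof (rule ccontr)
    assume "\<not> ?thesis"
    then have x: "Min R \<le> x" "x \<le> Max R" by auto
    obtain i j where ij: "(i, j) \<in> sampled (tr X r)" "x = inp X i j" using x_in sp by auto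
    then have P: "(i, j) \<in> positions" using sampled_positions by auto
    obtain i1 j1 where w: "(i1, j1) \<in> W" "Min R = inp X i1 j1" using MM(1) by (auto simp: R_def)
    obtain i2 j2 where w': "(i2, j2) \<in> W" "Max R = inp X i2 j2" using MM(2) by (auto simp: R_def)
    have "\<not> key X (i, j) < key X (i1, j1)" "\<not> key X (i2, j2) < key X (i, j)"
      using x ij w w' W_pos P by (auto simp flip: inp_less_iff)
    then have "(i, j) \<in> W" by (rule W_convex[OF P w(1) w'(1)])
    then show False using un ij by (auto simp: W_def untouched_def)
  qed
  have "real (Max R + 1 - Min R) \<le> 2 * real (p * n) / real p"
    by (rule two_balanced_gap[OF bal range(1) MM(4) range(2) gap p_pos])
  also have "\<dots> = 2 * n" using p_pos by simp
  finally have "Max R + 1 - Min R \<le> 2 * n" by linarith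
  moreover have "card R \<le> Max R + 1 - Min R" using card_mono[OF _ MM(3)] by simp
  ultimately show False using cardR gap_size by linarith
qed

lemma card_success_le:
  assumes "units > 0"
  shows "card {X. X \<subseteq> bits \<and> success A out p (p * n) r (inp X) \<omega>}
    \<le> r * exp (- (units / growth a r)) * 2 ^ card bits"
proof -
  have "growth a r * card (alive X r) < units" if "success A out p (p * n) r (inp X) \<omega>" for X
  proof -
    have "alive X r = {}" using that alive_imp_failure by blast
    then show ?thesis using assms by simp
  qed
  then have "card {X. X \<subseteq> bits \<and> success A out p (p * n) r (inp X) \<omega>} \<le>
      card {X. X \<subseteq> bits \<and> growth a r * card (alive X r) < units}"
    by (intro card_mono) (auto simp: finite_bits)
  then show ?thesis using card_few_alive[of r] by linarith
qed

end

section \<open>Towers\<close>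

fun tow :: "nat \<Rightarrow> nat" where
  "tow 0 = 1"
| "tow (Suc j) = 2 ^ tow j"

lemma le_tow: "j \<le> tow j"
proof (induction j)
  case (Suc j)
  show ?case using le_less_trans[OF Suc less_exp] by (simp add: Suc_le_eq)
qed simp

lemma tow_mono: "j \<le> j' \<Longrightarrow> tow j \<le> tow j'"
  by (rule lift_Suc_mono_le) (simp_all add: less_imp_le[OF less_exp])

lemma tow_less_of_log_iterates:
  fixes x :: real
  shows "(\<And>i. i \<le> j \<Longrightarrow> 1 < ((\<lambda>y. log 2 y) ^^ i) x) \<Longrightarrow> tow j < x"
proof (induction j arbitrary: x)
  case 0
  from 0[of 0] show ?case by simp
next
  case (Suc j)
  have x: "1 < x" using Suc.prems[of 0] by simp
  have "tow j < log 2 x"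
  proof (rule Suc.IH)
    fix i assume "i \<le> j"
    then have "1 < ((\<lambda>y. log 2 y) ^^ Suc i) x" by (intro Suc.prems) simp
    then show "1 < ((\<lambda>y. log 2 y) ^^ i) (log 2 x)" by (simp only: funpow_Suc_right o_apply)
  qed
  then have "2 powr tow j < x" using x by (simp add: less_log_iff)
  then show ?case by (simp add: powr_realpow)
qed

lemma tow_less:
  fixes x :: real
  assumes "j < log_star x"
  shows "tow j < x"
proof (rule tow_less_of_log_iterates)
  fix i assume "i \<le> j"
  then have "i < log_star x" using assms by simp
  then show "1 < ((\<lambda>y. log 2 y) ^^ i) x"
    unfolding log_star_def by (blast dest: not_less_Least intro: not_le_imp_less)
qed

section \<open>Growth against towers\<close>

lemma double_le_power: "2 * x \<le> 2 ^ x" if "0 < x" for x :: nat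
  using that by (induction x rule: nat_induct_non_zero) auto

text \<open>With \<open>x = K * growth a t\<close> the next value is at most
  \<open>2 ^ x * 2 ^ x \<le> 2 ^ 2 ^ x\<close>, so one superstep costs two levels of the tower. The
  factor \<open>K\<close> absorbs \<open>a\<close> and the 4.\<close>

lemma growth_le_tow:
  assumes K: "a + 4 \<le> K" "K \<le> tow j"
  shows "K * growth a t \<le> tow (j + 2 * t)"
proof (induction t)
  case 0
  then show ?case using K by simp
next
  case (Suc t)
  let ?x = "K * growth a t"
  have g: "1 \<le> growth a t" using growth_pos[of a t] by simp
  have "a * growth a t + 4 * 1 \<le> (a + 4) * growth a t"
    using g by (simp add: add_mult_distrib)
  also have "\<dots> \<le> ?x" using K by simp
  finally have e: "a * growth a t + 4 \<le> ?x" by simp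
  have "K * growth a (Suc t) = ?x * 2 ^ (a * growth a t + 4)" by simp
  also have "\<dots> \<le> 2 ^ ?x * 2 ^ ?x"
    using e by (intro mult_mono less_imp_le[OF less_exp] power_increasing) auto
  also have "\<dots> = 2 ^ (2 * ?x)" by (simp only: mult_2 power_add)
  also have "\<dots> \<le> 2 ^ 2 ^ ?x"
    using e by (intro power_increasing double_le_power) linarith+
  also have "\<dots> \<le> 2 ^ 2 ^ tow (j + 2 * t)"
    using Suc by (intro power_increasing) auto
  also have "\<dots> = tow (j + 2 * Suc t)" by simp
  finally show ?case .
qed

lemma linear_le_power: "32 * x \<le> 2 ^ x" if "8 \<le> x" for x :: nat
  using that by (induction x rule: dec_induct) auto

text \<open>One tower level absorbs a factor 32, as \<open>32 * x \<le> 2 ^ x\<close> from 8 on; so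
  \<open>r\<close> levels pay for parameters exponential in \<open>r\<close>.\<close>

lemma geometric_le_tow:
  assumes "8 \<le> b"
  shows "b * 32 ^ r \<le> tow (b + r)"
proof (induction r)
  case 0
  show ?case using le_tow by simp
next
  case (Suc r)
  have "8 * 1 \<le> b * 32 ^ r" using assms by (intro mult_mono) auto
  then have "8 \<le> tow (b + r)" using Suc by simp
  then have "32 * tow (b + r) \<le> tow (b + Suc r)" using linear_le_power by simp
  then show ?case using Suc by simp
qed

section \<open>Averaging over the hard inputs\<close>

text \<open>Averaging: the expected number of elements on which a random seed succeeds exceeds half
  of \<open>card \<X>\<close>. The seed comes from the support, where the sample budget is
  assumed.\<close>

lemma exists_good_seed:
  fixes D :: "'w pmf" and \<X> :: "'x set"
  assumes fin: "finite \<X>" "\<X> \<noteq> {}"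
    and prob: "\<And>X. X \<in> \<X> \<Longrightarrow> measure_pmf.prob D {\<omega>. S X \<omega>} > 1/2"
  shows "\<exists>\<omega>\<in>set_pmf D. card \<X> < 2 * card {X\<in>\<X>. S X \<omega>}"
proof (rule ccontr)
  assume "\<not> ?thesis"
  then have le: "2 * card {X\<in>\<X>. S X \<omega>} \<le> card \<X>" if "\<omega> \<in> set_pmf D" for \<omega>
    using that by (auto simp: not_less)
  have int: "integrable (measure_pmf D) (indicator {\<omega>. S X \<omega>} :: 'w \<Rightarrow> real)" for X
    by (rule measure_pmf.integrable_const_bound[of _ 1]) (auto simp: indicator_def)
  have "card \<X> / 2 = (\<Sum>X\<in>\<X>. 1/2)" by simp
  also have "\<dots> < (\<Sum>X\<in>\<X>. measure_pmf.prob D {\<omega>. S X \<omega>})"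
    using fin prob by (intro sum_strict_mono) auto
  also have "\<dots> = (\<Sum>X\<in>\<X>. measure_pmf.expectation D (indicator {\<omega>. S X \<omega>}))" by simp
  also have "\<dots> = measure_pmf.expectation D (\<lambda>\<omega>. \<Sum>X\<in>\<X>. indicator {\<omega>. S X \<omega>} \<omega>)"
    using int by (intro Bochner_Integration.integral_sum[symmetric])
  also have "\<dots> \<le> card \<X> / 2"
  proof (rule measure_pmf.integral_le_const)
    show "integrable (measure_pmf D) (\<lambda>\<omega>. \<Sum>X\<in>\<X>. indicator {\<omega>. S X \<omega>} \<omega> :: real)"
      using int by (intro Bochner_Integration.integrable_sum)
    have "(\<Sum>X\<in>\<X>. indicator {\<omega>. S X \<omega>} \<omega>) = real (card {X\<in>\<X>. S X \<omega>})" for \<omega>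
      using fin by (simp add: indicator_def sum.If_cases Int_def)
    then show "AE \<omega> in measure_pmf D. (\<Sum>X\<in>\<X>. indicator {\<omega>. S X \<omega>} \<omega>) \<le> card \<X> / 2"
      using le[THEN of_nat_mono[where 'a = real]] by (auto simp: AE_measure_pmf_iff mult.commute)
  qed
  finally show False by simp
qed

text \<open>Chooses the parameters. Per superstep, two tower levels go to \<open>growth\<close> and
  one to the factor \<open>32 ^ r\<close>, hence \<open>3 * r\<close>.\<close>

lemma no_algorithm:
  fixes C p n r :: nat and D :: "nat pmf" and A :: strategy and out :: outrule
  assumes C: "0 < C" and p: "tow (72 * C + 3 * r) \<le> p" and n: "p \<le> n"
    and budget: "\<And>\<omega> rk t. \<omega> \<in> set_pmf D \<Longrightarrow> valid_input p (p * n) rk \<Longrightarrow> t < r \<Longrightarrow>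
      card (step_samples A p n \<omega> rk t (run A p n \<omega> rk t)) \<le> C * p"
    and succ: "\<And>rk. valid_input p (p * n) rk \<Longrightarrow>
      measure_pmf.prob D {\<omega>. success A out p (p * n) r rk \<omega>} > 1/2"
  shows False
proof -
  define a where "a = 12 * C * 4 ^ r"
  define g where "g = growth a r"
  define k where "k = a * g"
  define m where "m = 3 * k * 4 ^ r"
  define s where "s = n div k"
  \<comment> \<open>Serves two uses of \<open>K * g \<le> p\<close>: it covers the
    \<open>16 ^ r\<close> in \<open>m\<close>, and as \<open>32 = 4 * 8\<close> it leaves
    \<open>8 ^ r\<close> after division by the \<open>4 ^ r\<close> of
    \<open>p_le_units\<close>.\<close>
  define K where "K = 72 * C * 32 ^ r"
  have K_le: "K * g \<le> p"
  proof -
    have "1 * 4 ^ r \<le> C * (32::nat) ^ r" using C by (intro mult_mono power_mono) auto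
    moreover have "C * 4 ^ r \<le> C * (32::nat) ^ r" by (intro mult_left_mono power_mono) auto
    moreover have "1 \<le> (4::nat) ^ r" by simp
    ultimately have "a + 4 \<le> K" unfolding a_def K_def mult.assoc by linarith
    moreover have "K \<le> tow (72 * C + r)" unfolding K_def using C by (intro geometric_le_tow) simp
    ultimately have "K * g \<le> tow (72 * C + r + 2 * r)" unfolding g_def by (rule growth_le_tow)
    then show ?thesis using p by (simp add: add.assoc)
  qed
  have g_pos: "0 < g" by (simp add: g_def growth_pos)
  have k_pos: "0 < k" using C g_pos by (simp add: k_def a_def)
  have m_le: "m \<le> p"
  proof -
    have "m = 36 * C * 16 ^ r * g"
    proof -
      have "(4::nat) ^ r * 4 ^ r = 16 ^ r" by (simp flip: power_mult_distrib)
      then show ?thesis unfolding m_def k_def a_def by (simp add: mult_ac)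
    qed
    also have "\<dots> \<le> K * g" unfolding K_def by (intro mult_mono power_mono) auto
    finally show ?thesis using K_le by simp
  qed
  have "3 * k * 1 \<le> m" unfolding m_def by (intro mult_left_mono) auto
  then have n_large: "3 * k \<le> n" using m_le n by simp
  then have s_pos: "0 < s" using k_pos by (simp add: s_def div_greater_zero_iff)
  have gap: "2 * n < 3 * k * s"
  proof -
    have "n < k * s + k" using dividend_less_times_div[OF k_pos, of n] by (simp add: s_def)
    then show ?thesis using n_large by simp
  qed
  have p_pos: "0 < p" using m_le \<open>3 * k * 1 \<le> m\<close> k_pos by linarith
  have inputs: "hard_inputs n r k m s"
    using k_pos s_pos gap by unfold_locales (auto simp: m_def s_def)
  \<comment> \<open>The inputs depend neither on the seed nor on the strategy, so the averaging runs
    over one fixed family.\<close>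
  define hard_inp where "hard_inp = hard_inputs.inp p n r m s"
  define hard_bits where "hard_bits = hard_instance.bits p r k"
  have valid: "valid_input p (p * n) (hard_inp X)" for X
    unfolding hard_inp_def by (rule hard_inputs.valid_inp[OF inputs p_pos])
  have inst: "hard_instance p n r k m s A \<omega> C a" if \<omega>: "\<omega> \<in> set_pmf D" for \<omega>
  proof -
    interpret hard_inputs p n r k m s A \<omega> by (rule inputs)
    show ?thesis
    proof
      show "card (picks X t) \<le> C * p" if t: "t < r" for X t
      proof -
        have "step_samples A p n \<omega> (inp X) t (tr X t) = (\<lambda>(i, j). (i, j, inp X i j)) ` picks X t"
          by (auto simp: step_samples_def picks_def image_def)
        moreover have "inj_on (\<lambda>(i, j). (i, j, inp X i j)) (picks X t)"
          by (auto intro: inj_onI)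
        ultimately show ?thesis
          using budget[OF \<omega> valid_inp[OF p_pos] t, of X] by (simp add: card_image tr_def)
      qed
    qed (use C m_le in \<open>auto simp: a_def k_def g_def\<close>)
  qed
  have "finite hard_bits" unfolding hard_bits_def
    by (metis hard_instance.finite_bits inst set_pmf_not_empty all_not_in_conv)
  then obtain \<omega> where \<omega>: "\<omega> \<in> set_pmf D"
    and half: "card (Pow hard_bits) < 2 * card {X\<in>Pow hard_bits. success A out p (p * n) r (hard_inp X) \<omega>}"
    using exists_good_seed[of "Pow hard_bits" D "\<lambda>X \<omega>. success A out p (p * n) r (hard_inp X) \<omega>"]
      succ[OF valid] by auto
  interpret hard_instance p n r k m s A \<omega> C a by (rule inst[OF \<omega>])
  have units: "(2 * r + 1) * g \<le> units"
  proof -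
    have "6 * 4 ^ r * (12 * C * 8 ^ r * g) = K * g"
    proof -
      have "(4::nat) ^ r * 8 ^ r = 32 ^ r" by (simp flip: power_mult_distrib)
      then show ?thesis unfolding K_def by (simp add: mult_ac)
    qed
    also have "\<dots> \<le> 6 * 4 ^ r * units" using K_le p_le_units by simp
    finally have "12 * C * 8 ^ r * g \<le> units" by (simp add: mult_ac)
    moreover have "2 * r + 1 \<le> 12 * C * 8 ^ r"
    proof -
      have "r < (2::nat) ^ r" by (rule less_exp)
      also have "(2::nat) ^ r \<le> 8 ^ r" by (intro power_mono) auto
      finally have "2 * r + 1 \<le> 12 * 1 * 8 ^ r" by simp
      also have "\<dots> \<le> 12 * C * 8 ^ r" using C by (intro mult_mono) auto
      finally show ?thesis .
    qed
    ultimately show ?thesis by (meson le_trans mult_le_mono1)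
  qed
  then have "0 < units" using g_pos by (simp add: add_mult_distrib)
  \<comment> \<open>The union bound is at most one half because
    \<open>exp (units / g) \<ge> 1 + units / g \<ge> 2 * r\<close>.\<close>
  have "r * exp (- (units / growth a r)) \<le> 1 / 2"
  proof -
    have "real ((2 * r + 1) * g) \<le> real units" using units by (rule of_nat_mono)
    then have "real (2 * r + 1) \<le> units / g"
      using g_pos by (simp only: le_divide_eq of_nat_mult of_nat_0_less_iff if_True)
    moreover have "1 + units / g \<le> exp (units / g)" by (rule exp_ge_add_one_self)
    ultimately have "2 * r \<le> exp (units / g)" by linarith
    then show ?thesis by (simp add: g_def exp_minus field_simps)
  qed
  then have "r * exp (- (units / growth a r)) * 2 ^ card hard_bits \<le> 1 / 2 * 2 ^ card hard_bits"
    by (intro mult_right_mono) auto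
  moreover have "real (card {X\<in>Pow hard_bits. success A out p (p * n) r (hard_inp X) \<omega>})
      \<le> r * exp (- (units / growth a r)) * 2 ^ card hard_bits"
    using card_success_le[OF \<open>0 < units\<close>, of out] by (simp add: hard_inp_def hard_bits_def)
  ultimately have "2 * real (card {X\<in>Pow hard_bits. success A out p (p * n) r (hard_inp X) \<omega>}) \<le> 2 ^ card hard_bits"
    by linarith
  moreover have "real (card (Pow hard_bits)) = 2 ^ card hard_bits" using \<open>finite hard_bits\<close> by (simp add: card_Pow)
  ultimately show False using half by linarith
qed

theorem theorem3p20:
  "\<forall>C::real. C > 0 \<longrightarrow>
     (\<exists>c::real. c > 0 \<and> (\<exists>p0::nat. \<forall>p\<ge>p0. \<exists>N0::nat. \<forall>N\<ge>N0. p dvd N \<longrightarrow>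
       (\<forall>(D::nat pmf) (A::strategy) (out::outrule) (r::nat).
          (\<forall>\<omega>\<in>set_pmf D. \<forall>rk. valid_input p N rk \<longrightarrow> (\<forall>t<r.
              real (card (step_samples A p (N div p) \<omega> rk t (run A p (N div p) \<omega> rk t)))
                \<le> C * real p)) \<and>
          (\<forall>rk. valid_input p N rk \<longrightarrow>
              measure_pmf.prob D {\<omega>. success A out p N r rk \<omega>} > 1/2)
          \<longrightarrow> real r \<ge> c * real (log_star (real p)))))"
proof (intro allI impI)
  fix C :: real assume C: "C > 0"
  define C' where "C' = nat \<lceil>C\<rceil>"
  define B where "B = 72 * C'"
  have C': "0 < C'" "C \<le> C'" using C by (auto simp: C'_def)
  have main: "1 / 4 * real (log_star (real p)) \<le> real r"
    if p: "tow (4 * B + 4) \<le> p" and N: "p * p \<le> N" "p dvd N"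
      and bud: "\<forall>\<omega>\<in>set_pmf D. \<forall>rk. valid_input p N rk \<longrightarrow> (\<forall>t<r.
              real (card (step_samples A p (N div p) \<omega> rk t (run A p (N div p) \<omega> rk t)))
                \<le> C * real p)"
      and succ: "\<forall>rk. valid_input p N rk \<longrightarrow>
              measure_pmf.prob D {\<omega>. success A out p N r rk \<omega>} > 1/2"
    for p N r :: nat and D A out
  proof (rule ccontr)
    assume "\<not> ?thesis"
    then have r: "4 * r < log_star (real p)" by simp
    have "0 < tow (4 * B + 4)" using le_tow[of "4 * B + 4"] by simp
    then have p_pos: "0 < p" using p by simp
    have Np: "p * (N div p) = N" using N by simp
    have "tow (B + 3 * r) \<le> p"
    \<comment> \<open>Either the tower height is bounded in terms of \<open>C\<close> and the
      threshold on \<open>p\<close> suffices, or \<open>B < r\<close> and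
      \<open>B + 3 * r < 4 * r < log_star p\<close>. This is where the constant \<open>1 / 4\<close>
      comes from.\<close>
    proof (cases "B + 3 * r \<le> 4 * B + 4")
      case True
      then show ?thesis using tow_mono p le_trans by blast
    next
      case False
      then have "tow (B + 3 * r) < real p" using r by (intro tow_less) simp
      then show ?thesis by simp
    qed
    moreover have "p \<le> N div p"
      using div_le_mono[OF N(1), of p] p_pos by simp
    moreover have "card (step_samples A p (N div p) \<omega> rk t (run A p (N div p) \<omega> rk t)) \<le> C' * p"
      if "\<omega> \<in> set_pmf D" "valid_input p N rk" "t < r" for \<omega> rk t
    proof -
      have "real (card (step_samples A p (N div p) \<omega> rk t (run A p (N div p) \<omega> rk t))) \<le> C * p"
        using bud that by blast
      also have "\<dots> \<le> real C' * p" using C' by (intro mult_right_mono) auto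
      finally show ?thesis by (simp only: of_nat_mult[symmetric] of_nat_le_iff)
    qed
    ultimately show False
      using no_algorithm[of C' r p "N div p" D A out] C' succ unfolding B_def Np by blast
  qed
  show "\<exists>c::real. c > 0 \<and> (\<exists>p0::nat. \<forall>p\<ge>p0. \<exists>N0::nat. \<forall>N\<ge>N0. p dvd N \<longrightarrow>
       (\<forall>(D::nat pmf) (A::strategy) (out::outrule) (r::nat).
          (\<forall>\<omega>\<in>set_pmf D. \<forall>rk. valid_input p N rk \<longrightarrow> (\<forall>t<r.
              real (card (step_samples A p (N div p) \<omega> rk t (run A p (N div p) \<omega> rk t)))
                \<le> C * real p)) \<and>
          (\<forall>rk. valid_input p N rk \<longrightarrow>
              measure_pmf.prob D {\<omega>. success A out p N r rk \<omega>} > 1/2)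
          \<longrightarrow> real r \<ge> c * real (log_star (real p))))"
  proof (intro exI conjI allI impI)
    show "(0::real) < 1 / 4" by simp
  qed (rule main; blast)
qed

end
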